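(* Let $p\in\mathbb{R}\setminus\{0\}$, let $0<a<b$, and let $f:[a,b]\to\mathbb{R}$ be symmetrized $p$-convex on $[a,b]$. Then for every $x\in[a,b]$, $$f\left(\left[\frac{a^{p}+b^{p}}{2}\right]^{1/p}\right)\le P_{(f;p)}(x)\le \frac{f(a)+f(b)}{2}.$$
   Context: Let $p\in\mathbb{R}\setminus\{0\}$. A function $h:I\to\mathbb{R}$ on a real interval $I\subseteq(0,\infty)$ is called $p$-convex if $h\left([tx^{p}+(1-t)y^{p}]^{1/p}\right)\le t\,h(x)+(1-t)\,h(y)$ for all $x,y\in I$ and $t\in[0,1]$. For $f:[a,b]\to\mathbb{R}$ with $[a,b]\subseteq(0,\infty)$, the $p$-symmetrical transform of $f$ on $[a,b]$ is the function $P_{(f;p)}(x)=\frac12\left[f(x)+f\left([a^{p}+b^{p}-x^{p}]^{1/p}\right)\right]$, $x\in[a,b]$. The function $f$ is called symmetrized $p$-convex on $[a,b]$ if $P_{(f;p)}$ is $p$-convex on $[a,b]$. *)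

theory Defs
  imports "HOL-Analysis.Analysis"
begin

text \<open>
  A function on an interval is represented by a total function on the reals, of which only the
  values on that interval are used. Every base of \<open>powr\<close> below is positive when the points lie
  in the interval in question, so \<open>powr\<close> is the usual real power.
\<close>

definition p_convex_on :: "real \<Rightarrow> real set \<Rightarrow> (real \<Rightarrow> real) \<Rightarrow> bool" where
  "p_convex_on p I h \<longleftrightarrow>
     is_interval I \<and> I \<subseteq> {0<..} \<and>
     (\<forall>x\<in>I. \<forall>y\<in>I. \<forall>t\<in>{0..1}.
        h ((t * x powr p + (1 - t) * y powr p) powr (1 / p)) \<le> t * h x + (1 - t) * h y)"

definition p_sym_transform :: "real \<Rightarrow> real \<Rightarrow> real \<Rightarrow> (real \<Rightarrow> real) \<Rightarrow> real \<Rightarrow> real" where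
  "p_sym_transform p a b f x =
     1 / 2 * (f x + f ((a powr p + b powr p - x powr p) powr (1 / p)))"

definition symmetrized_p_convex_on :: "real \<Rightarrow> real \<Rightarrow> real \<Rightarrow> (real \<Rightarrow> real) \<Rightarrow> bool" where
  "symmetrized_p_convex_on p a b f \<longleftrightarrow> p_convex_on p {a..b} (p_sym_transform p a b f)"

end

theory Submission
  imports Defs
begin

text \<open>
  The reflection \<open>x \<mapsto> (a powr p + b powr p - x powr p) powr (1 / p)\<close> is an involution of
  \<open>{a..b}\<close> that exchanges \<open>a\<close> and \<open>b\<close>, leaves the transform invariant and fixes the
  \<open>p\<close>-mean of \<open>a\<close> and \<open>b\<close>. This mean is also the \<open>p\<close>-mean of \<open>x\<close> and its reflection,
  so \<open>p\<close>-convexity gives the lower bound; the upper bound is \<open>p\<close>-convexity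
  between \<open>a\<close> and \<open>b\<close>, at which the transform has the same value.
\<close>

text \<open>On the positive reals \<open>powr p\<close> is monotone, in a direction given by the
  sign of \<open>p\<close>; \<open>closed_segment\<close> ignores the order of its endpoints and so
  covers both signs.\<close>

lemma powr_in_closed_segment:
  fixes a b p x :: real
  assumes "0 < a" "x \<in> {a..b}"
  shows "x powr p \<in> closed_segment (a powr p) (b powr p)"
proof (cases "p \<ge> 0")
  case True
  then have "a powr p \<le> x powr p" "x powr p \<le> b powr p"
    using assms by (auto intro: powr_mono2)
  then show ?thesis by (simp add: closed_segment_eq_real_ivl)
next
  case False
  then have "x powr p \<le> a powr p" "b powr p \<le> x powr p"
    using assms by (auto intro: powr_mono2')
  then show ?thesis by (auto simp: closed_segment_eq_real_ivl)
qed

text \<open>Raising to \<open>1 / p\<close> undoes \<open>powr p\<close>, so the preceding lemma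
  applies with exponent \<open>1 / p\<close> to the interval between the two powers, once these are
  put in order.\<close>

lemma powr_inverse_in_interval:
  fixes a b p w :: real
  assumes "p \<noteq> 0" "0 < a" "a \<le> b" and w: "w \<in> closed_segment (a powr p) (b powr p)"
  shows "w > 0" "w powr (1 / p) \<in> {a..b}"
proof -
  have pos: "a powr p > 0" "b powr p > 0" using assms by auto
  then show "w > 0"
    using w unfolding closed_segment_eq_real_ivl by (smt (verit) atLeastAtMost_iff)
  have inv: "(a powr p) powr (1 / p) = a" "(b powr p) powr (1 / p) = b"
    using assms by (simp_all add: powr_powr)
  show "w powr (1 / p) \<in> {a..b}"
  proof (cases "a powr p \<le> b powr p")
    case True
    then have "w \<in> {a powr p..b powr p}"
      using w by (simp add: closed_segment_eq_real_ivl)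
    from powr_in_closed_segment[OF pos(1) this, of "1 / p"] show ?thesis
      using \<open>a \<le> b\<close> by (simp add: inv closed_segment_eq_real_ivl)
  next
    case False
    then have "w \<in> {b powr p..a powr p}"
      using w by (simp add: closed_segment_eq_real_ivl)
    from powr_in_closed_segment[OF pos(2) this, of "1 / p"] show ?thesis
      using \<open>a \<le> b\<close> by (auto simp: inv closed_segment_eq_real_ivl split: if_splits)
  qed
qed

theorem theorem12:
  fixes p a b :: real and f :: "real \<Rightarrow> real"
  assumes "p \<noteq> 0" and "0 < a" and "a < b"
    and "symmetrized_p_convex_on p a b f"
  shows "\<forall>x\<in>{a..b}.
    f (((a powr p + b powr p) / 2) powr (1 / p)) \<le> p_sym_transform p a b f x \<and>
    p_sym_transform p a b f x \<le> (f a + f b) / 2"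
proof
  fix x assume x: "x \<in> {a..b}"
  define A where "A = a powr p + b powr p"
  define P where "P = p_sym_transform p a b f"
  define q where "q = (A - x powr p) powr (1 / p)"
  define m where "m = (A / 2) powr (1 / p)"
  have P: "P z = (f z + f ((A - z powr p) powr (1 / p))) / 2" for z
    by (simp add: P_def p_sym_transform_def A_def)
  have conv: "P ((t * u powr p + (1 - t) * v powr p) powr (1 / p)) \<le> t * P u + (1 - t) * P v"
    if "u \<in> {a..b}" "v \<in> {a..b}" "t \<in> {0..1}" for t u v
    using assms(4) that unfolding symmetrized_p_convex_on_def p_convex_on_def P_def by blast
  have pos: "a powr p > 0" "b powr p > 0" using assms by auto
  have inv: "(z powr p) powr (1 / p) = z" if "z > 0" for z
    using that \<open>p \<noteq> 0\<close> by (simp add: powr_powr)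
  have seg: "x powr p \<in> closed_segment (a powr p) (b powr p)"
    using powr_in_closed_segment assms(2) x by blast
  \<comment> \<open>Subtraction from \<open>A\<close> swaps the endpoints of the segment and so maps
    it to itself.\<close>
  then have "A - x powr p \<in> closed_segment (a powr p) (b powr p)"
    by (auto simp: A_def closed_segment_eq_real_ivl split: if_splits)
  then have "A - x powr p > 0" and q: "q \<in> {a..b}"
    using powr_inverse_in_interval[of p a b "A - x powr p"] assms by (auto simp: q_def)
  then have qp: "q powr p = A - x powr p"
    using \<open>p \<noteq> 0\<close> by (simp add: q_def powr_powr)
  have Pq: "P q = P x"
    using x \<open>0 < a\<close> by (simp add: P qp inv flip: q_def)
  have "m powr p = A / 2"
    using pos \<open>p \<noteq> 0\<close> by (simp add: m_def powr_powr A_def)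
  then have "A - m powr p = A / 2"
    by simp
  then have Pm: "P m = f m"
    by (simp only: P flip: m_def) simp
  \<comment> \<open>The powers \<open>x powr p\<close> and \<open>q powr p\<close> add up to
    \<open>A\<close>, so weight 1/2 yields \<open>m\<close>.\<close>
  have "P m \<le> P x"
    using conv[OF x q, of "1/2"] by (simp add: qp Pq m_def field_simps)
  moreover have "P x \<le> (f a + f b) / 2"
  proof -
    \<comment> \<open>The weight \<open>s\<close> exhibits \<open>x\<close> as a weighted
      \<open>p\<close>-mean of the endpoints.\<close>
    obtain s where s: "s \<in> {0..1}" "x powr p = (1 - s) * a powr p + s * b powr p"
      using seg by (auto simp: in_segment)
    have Pab: "P a = (f a + f b) / 2" "P b = (f a + f b) / 2"
      using assms by (simp_all add: P A_def inv)
    have "(s * b powr p + (1 - s) * a powr p) powr (1 / p) = x"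
      using s(2) inv[of x] x \<open>0 < a\<close> by (simp add: add.commute)
    then have "P x \<le> s * P b + (1 - s) * P a"
      using conv[of b a s] s(1) \<open>a < b\<close> by simp
    also have "\<dots> = (f a + f b) / 2"
      unfolding Pab by (simp flip: distrib_right del: times_divide_eq_right)
    finally show ?thesis .
  qed
  ultimately show "f (((a powr p + b powr p) / 2) powr (1 / p)) \<le> p_sym_transform p a b f x \<and>
      p_sym_transform p a b f x \<le> (f a + f b) / 2"
    using Pm by (simp add: P_def m_def A_def)
qed

end
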